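(* Let $\alpha>0$ and $s>0$. The quantities $a_n=a_n(s)$ and $b_n=b_n(s)$ satisfy the non-linear difference equations $$b_{n+1}+b_n=s-(2n+1+\alpha+a_n)a_n,\qquad n\ge0,$$ $$(b_n^2-sb_n)(a_n+a_{n-1})=[ns-(2n+\alpha)b_n]\,a_na_{n-1},\qquad n\ge1,$$ with the initial conditions $$a_0(s)=\sqrt{s}\,\frac{K_{\alpha}(2\sqrt{s})}{K_{\alpha+1}(2\sqrt{s})},\qquad b_0(s)=0,$$ where $K_\nu$ denotes the MacDonald function (modified Bessel function of the second kind).
   Context: Fix $\alpha>0$. For $s>0$ let $w(x,s)=x^{\alpha}e^{-x-s/x}$ on $(0,\infty)$. Let $P_n(x)=P_n(x,s)$, $n\ge0$, be the monic polynomials of degree $n$ with $\int_0^\infty P_jP_k\,w(x,s)\,dx=h_j(s)\delta_{jk}$. Define $$a_n(s):=\frac{s}{h_n}\int_0^\infty\frac{P_n(y)^2}{y}\,w(y,s)\,dy\ (n\ge0),\qquad b_n(s):=\frac{s}{h_{n-1}}\int_0^\infty\frac{P_n(y)P_{n-1}(y)}{y}\,w(y,s)\,dy\ (n\ge1),$$ and $b_0:=0$. *)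

theory Defs
  imports "HOL-Analysis.Analysis" "HOL-Computational_Algebra.Polynomial"
begin

definition weight :: "real \<Rightarrow> real \<Rightarrow> real \<Rightarrow> real" where
  "weight \<alpha> s x = x powr \<alpha> * exp (- x - s / x)"

(* All integrals are Lebesgue integrals over the open half-line; for s > 0 the weight decays
   faster than any power at 0 and at infinity, so every integrand below is integrable. *)

definition monic_orthogonal_polys ::
    "real \<Rightarrow> real \<Rightarrow> (nat \<Rightarrow> real poly) \<Rightarrow> (nat \<Rightarrow> real) \<Rightarrow> bool" where
  "monic_orthogonal_polys \<alpha> s P h \<longleftrightarrow>
     (\<forall>n. degree (P n) = n \<and> lead_coeff (P n) = 1) \<and>
     (\<forall>j k. (LBINT x:{0<..}. poly (P j) x * poly (P k) x * weight \<alpha> s x)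
              = (if j = k then h j else 0))"

definition a_coeff ::
    "real \<Rightarrow> real \<Rightarrow> (nat \<Rightarrow> real poly) \<Rightarrow> (nat \<Rightarrow> real) \<Rightarrow> nat \<Rightarrow> real" where
  "a_coeff \<alpha> s P h n =
     s / h n * (LBINT y:{0<..}. (poly (P n) y)\<^sup>2 / y * weight \<alpha> s y)"

definition b_coeff ::
    "real \<Rightarrow> real \<Rightarrow> (nat \<Rightarrow> real poly) \<Rightarrow> (nat \<Rightarrow> real) \<Rightarrow> nat \<Rightarrow> real" where
  "b_coeff \<alpha> s P h n =
     (if n = 0 then 0
      else s / h (n - 1) *
        (LBINT y:{0<..}. poly (P n) y * poly (P (n - 1)) y / y * weight \<alpha> s y))"

(* The modified Bessel function of the second kind of real order, for real argument z > 0,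
   given by its classical integral  K_nu(z) = int_0^infinity exp(-z cosh t) cosh(nu t) dt
   (Abramowitz and Stegun 9.6.24; DLMF 10.32.9), which is valid for integer and non-integer
   orders alike. The value for z <= 0 is meaningless. *)
definition bessel_K :: "real \<Rightarrow> real \<Rightarrow> real" where
  "bessel_K \<nu> z = (LBINT t:{0<..}. exp (- z * cosh t) * cosh (\<nu> * t))"

end

(* Write <f> for the integral of f against the weight.  Since P_n is orthogonal to all lower
   degrees, <P_n f / y> depends on f only through f(0) and, if deg f = n + 1, the leading
   coefficient; likewise <P_n f / y^2> involves only f(0) and f'(0).  Hence a_n, a_{n-1}, b_n are
   products of the values of P_n, P_{n-1} at 0 with <P_n / y> and <P_{n-1} / y>, which gives
   b_n^2 - s b_n = (h_n / h_{n-1}) a_n a_{n-1}.  Integrating the derivatives of P_n^2 w,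
   P_n P_{n-1} w and P_{n-1}^2 w and eliminating <P_n / y^2>, <P_{n-1} / y^2> yields
   n s - (2 n + alpha) b_n = (h_n / h_{n-1}) (a_n + a_{n-1}); the two combine to the second
   equation.  The first one is the three-term recurrence tested against P_n / y, whose diagonal
   coefficient 2 n + 1 + alpha + a_n comes from integrating the derivative of y P_n^2 w.  The
   initial value follows from the substitution y = sqrt(s) exp(t). *)

theory Submission
  imports Defs "HOL-Real_Asymp.Real_Asymp"
begin

section \<open>Integrability of the weight and its decay at both ends\<close>

lemma weight_measurable [measurable]: "weight \<nu> s \<in> borel_measurable borel"
  unfolding weight_def[abs_def] by measurable

text \<open>A single term of the series of \<open>exp (s / x)\<close> bounds it from below. So this
  factor of the weight supplies any power of \<open>x\<close> near 0.\<close>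

lemma exp_minus_inverse_le:
  fixes s x :: real
  assumes "0 < s" "0 < x"
  shows "exp (- s / x) \<le> fact k / s ^ k * x ^ k"
proof -
  have "t ^ k / fact k \<le> exp t" if "0 < t" for t :: real
    using sum_le_suminf[OF summable_exp_generic[of t], of "{k}"] that
    by (simp add: exp_def divide_inverse_commute)
  then have "(s / x) ^ k / fact k \<le> exp (s / x)"
    using assms by simp
  then have "1 / exp (s / x) \<le> 1 / ((s / x) ^ k / fact k)"
    using assms by (intro divide_left_mono) auto
  then show ?thesis
    using assms by (simp add: exp_minus field_simps)
qed

lemma weight_tendsto_at_right_0:
  assumes "0 < s"
  shows "(weight \<nu> s \<longlongrightarrow> 0) (at_right 0)"
  using assms unfolding weight_def[abs_def] by real_asymp

lemma weight_tendsto_at_top: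
  assumes "0 < s"
  shows "(weight \<nu> s \<longlongrightarrow> 0) at_top"
  using assms unfolding weight_def[abs_def] by real_asymp

lemma set_integrable_weight:
  assumes s: "0 < s"
  shows "set_integrable lborel {0<..} (weight \<nu> s)"
proof -
  \<comment> \<open>With this \<open>k\<close> the exponent \<open>z\<close> is positive, so a Gamma
    integrand dominates the weight for every real \<nu>, negative ones included.\<close>
  obtain k :: nat where k: "- \<nu> - 1 < real k"
    using reals_Archimedean2 by blast
  define z where "z = \<nu> + real k + 1"
  have "0 < z" using k by (simp add: z_def)
  let ?g = "\<lambda>t::real. indicator {0..} t * t powr (z - 1) / exp t"
  have "(\<integral>\<^sup>+ t. ennreal (?g t) \<partial>lborel) = Gamma z"
    by (rule Gamma_conv_nn_integral_real[symmetric]) fact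
  then have "integrable lborel ?g"
    by (intro integrableI_nn_integral_finite) (auto simp: \<open>0 < z\<close> Gamma_real_pos less_imp_le)
  then have g: "set_integrable lborel {0<..} (\<lambda>x. fact k / s ^ k * ?g x)"
    unfolding set_integrable_def
    by (intro integrable_mult_indicator integrable_mult_right) auto
  show ?thesis
  proof (rule set_integrable_bound[OF g])
    show "set_borel_measurable lborel {0<..} (weight \<nu> s)"
      unfolding set_borel_measurable_def by measurable
    have "norm (weight \<nu> s x) \<le> norm (fact k / s ^ k * ?g x)" if x: "0 < x" for x
    proof -
      have "weight \<nu> s x = x powr \<nu> * exp (- x) * exp (- s / x)"
        by (simp add: weight_def flip: exp_add)
      also have "\<dots> \<le> x powr \<nu> * exp (- x) * (fact k / s ^ k * x ^ k)"
        using exp_minus_inverse_le[OF s x] by (intro mult_left_mono) auto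
      also have "\<dots> = fact k / s ^ k * ?g x"
        using x by (simp add: z_def powr_add powr_realpow exp_minus field_simps)
      finally show ?thesis
        using x s by (simp add: weight_def)
    qed
    then show "AE x in lborel. x \<in> {0<..} \<longrightarrow> norm (weight \<nu> s x) \<le> norm (fact k / s ^ k * ?g x)"
      by auto
  qed
qed

text \<open>The induction step on polynomials: with \<nu> arbitrary, the factor \<open>x\<close> is
  absorbed into the exponent.\<close>

lemma poly_pCons_times_weight:
  assumes "0 < x"
  shows "poly (pCons c q) x * weight \<nu> s x
    = c * weight \<nu> s x + poly q x * weight (\<nu> + 1) s x"
  using assms by (simp add: weight_def powr_add algebra_simps)

lemma set_integrable_poly_weight:
  assumes "0 < s"
  shows "set_integrable lborel {0<..} (\<lambda>x. poly q x * weight \<nu> s x)"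
proof (induction q arbitrary: \<nu>)
  case 0
  then show ?case by (simp add: set_integrable_def)
next
  case (pCons c q)
  have "set_integrable lborel {0<..}
    (\<lambda>x. c * weight \<nu> s x + poly q x * weight (\<nu> + 1) s x)"
    using set_integrable_weight[OF assms] pCons.IH by simp
  then show ?case
    by (rule set_integrable_cong[THEN iffD1, rotated -1])
       (simp_all only: poly_pCons_times_weight greaterThan_iff)
qed

text \<open>Makes the boundary terms vanish when integrating by parts.\<close>

lemma poly_weight_tendsto:
  assumes "F = at_right 0 \<or> F = at_top" and "0 < s"
  shows "((\<lambda>x. poly q x * weight \<nu> s x) \<longlongrightarrow> 0) F"
proof (induction q arbitrary: \<nu>)
  case 0
  then show ?case by simp
next
  case (pCons c q)
  have "((\<lambda>x. c * weight \<nu> s x + poly q x * weight (\<nu> + 1) s x) \<longlongrightarrow> c * 0 + 0) F"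
    using assms pCons.IH
    by (intro tendsto_intros) (auto simp: weight_tendsto_at_right_0 weight_tendsto_at_top)
  moreover have "\<forall>\<^sub>F x in F. 0 < x"
    using assms by (auto simp: eventually_at_right_less eventually_gt_at_top)
  then have "\<forall>\<^sub>F x in F. c * weight \<nu> s x + poly q x * weight (\<nu> + 1) s x
      = poly (pCons c q) x * weight \<nu> s x"
    by eventually_elim (rule poly_pCons_times_weight[symmetric])
  ultimately show ?case
    by (simp add: tendsto_cong)
qed

section \<open>The weighted integral as a linear functional on polynomials\<close>

definition weighted_integral :: "real \<Rightarrow> real \<Rightarrow> real poly \<Rightarrow> real" where
  "weighted_integral s \<nu> q = (LBINT x:{0<..}. poly q x * weight \<nu> s x)"

lemma weighted_integral_smult:
  "weighted_integral s \<nu> (smult c q) = c * weighted_integral s \<nu> q"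
  by (simp add: weighted_integral_def mult.assoc)

lemma weighted_integral_0 [simp]: "weighted_integral s \<nu> 0 = 0"
  by (simp add: weighted_integral_def)

text \<open>Division by the variable is encoded as lowering \<nu>, so integrands with
  \<open>1 / x\<close> or \<open>1 / x ^ 2\<close> stay polynomial times weight.\<close>

lemma weighted_integral_pCons_0:
  "weighted_integral s \<nu> (pCons 0 q) = weighted_integral s (\<nu> + 1) q"
  unfolding weighted_integral_def
  by (rule set_lebesgue_integral_cong) (auto simp: weight_def powr_add)

context
  fixes s :: real
  assumes s_pos: "0 < s"
begin

lemma weighted_integral_add:
  "weighted_integral s \<nu> (p + q) = weighted_integral s \<nu> p + weighted_integral s \<nu> q"
  using set_integral_add(2)[OF set_integrable_poly_weight set_integrable_poly_weight, OF s_pos s_pos]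
  by (simp add: weighted_integral_def distrib_right)

lemma weighted_integral_diff:
  "weighted_integral s \<nu> (p - q) = weighted_integral s \<nu> p - weighted_integral s \<nu> q"
  using weighted_integral_add[of \<nu> "p - q" q] by simp

text \<open>The logarithmic derivative of the weight is \<open>\<nu> / x + s / x ^ 2 - 1\<close>,
  and the integral of the derivative of \<open>poly q x * weight \<nu> s x\<close> is zero.\<close>

lemma weighted_integral_by_parts:
  "weighted_integral s \<nu> (pderiv q) + \<nu> * weighted_integral s (\<nu> - 1) q
    + s * weighted_integral s (\<nu> - 2) q = weighted_integral s \<nu> q"
proof -
  let ?F = "\<lambda>x. poly q x * weight \<nu> s x"
  let ?f = "\<lambda>x. poly (pderiv q) x * weight \<nu> s x + (\<nu> * (poly q x * weight (\<nu> - 1) s x)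
    + (s * (poly q x * weight (\<nu> - 2) s x) - poly q x * weight \<nu> s x))"
  note int = set_integrable_poly_weight[OF s_pos]
  have "(LBINT x=ereal 0..\<infinity>. ?f x) = 0 - 0"
  proof (rule interval_integral_FTC_integrable)
    fix x :: real assume "ereal 0 < ereal x"
    then have x: "0 < x" by simp
    have "(?F has_real_derivative ?f x) (at x)"
      unfolding weight_def
      using x by (auto intro!: derivative_eq_intros
          simp: powr_diff powr_numeral field_simps power2_eq_square)
    then show "(?F has_vector_derivative ?f x) (at x)"
      by (simp add: has_real_derivative_iff_has_vector_derivative)
    show "isCont ?f x"
      unfolding weight_def using x by (intro continuous_intros) auto
  next
    show "set_integrable lborel (einterval (ereal 0) \<infinity>) ?f"
      by (auto intro!: set_integral_add set_integral_diff int)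
    show "((?F \<circ> real_of_ereal) \<longlongrightarrow> 0) (at_right (ereal 0))"
      unfolding ereal_tendsto_simps by (rule poly_weight_tendsto) (use s_pos in auto)
    show "((?F \<circ> real_of_ereal) \<longlongrightarrow> 0) (at_left \<infinity>)"
      unfolding ereal_tendsto_simps by (rule poly_weight_tendsto) (use s_pos in auto)
  qed simp
  then have "(LBINT x:{0<..}. ?f x) = 0"
    unfolding interval_integral_to_infinity_eq by simp
  moreover have "(LBINT x:{0<..}. ?f x) = weighted_integral s \<nu> (pderiv q)
      + (\<nu> * weighted_integral s (\<nu> - 1) q
      + (s * weighted_integral s (\<nu> - 2) q - weighted_integral s \<nu> q))"
    unfolding weighted_integral_def using int by simp
  ultimately show ?thesis by simp
qed

text \<open>The integrand is nonnegative and, for nonzero \<open>q\<close>, vanishes on the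
  half-line only at finitely many roots; this would make the unit interval a null set.\<close>

lemma weighted_integral_square_eq_0:
  assumes "weighted_integral s \<nu> (q * q) = 0"
  shows "q = 0"
proof (rule ccontr)
  assume "q \<noteq> 0"
  let ?f = "\<lambda>x. indicator {0<..} x *\<^sub>R (poly (q * q) x * weight \<nu> s x)"
  have "AE x in lborel. ?f x = 0"
    using assms set_integrable_poly_weight[OF s_pos, of "q * q" \<nu>]
    by (subst integral_nonneg_eq_0_iff_AE[symmetric])
       (auto simp: weighted_integral_def set_lebesgue_integral_def set_integrable_def
          indicator_def weight_def)
  moreover have "AE x in lborel. x \<notin> {x. poly q x = 0}"
    by (intro AE_not_in finite_imp_null_set_lborel poly_roots_finite \<open>q \<noteq> 0\<close>)
  ultimately have "AE x in lborel. x \<notin> {0<..<1::real}"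
    by eventually_elim (auto simp: weight_def)
  then have "{0<..<1::real} \<in> null_sets lborel"
    by (subst (asm) AE_iff_null_sets[symmetric]) auto
  then show False
    by (auto simp: null_sets_def)
qed

end

lemma pderiv_square: "pderiv (q * q) = smult 2 (q * pderiv q)"
  for q :: "real poly"
proof -
  have "smult 2 (q * pderiv q) = smult (1 + 1) (q * pderiv q)"
    by simp
  also have "\<dots> = q * pderiv q + q * pderiv q"
    by (simp only: smult_add_left smult_1_left)
  finally show ?thesis
    by (simp add: pderiv_mult)
qed

section \<open>Integrals of \<open>P n\<close> times a polynomial, also divided by the variable or
  its square\<close>

locale monic_orthogonal =
  fixes \<alpha> s :: real and P :: "nat \<Rightarrow> real poly" and h :: "nat \<Rightarrow> real"
  assumes s_pos: "0 < s"
    and monic_orthogonal_polys: "monic_orthogonal_polys \<alpha> s P h"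
begin

abbreviation (input) "J0 \<equiv> weighted_integral s \<alpha>"
abbreviation (input) "J1 \<equiv> weighted_integral s (\<alpha> - 1)"
abbreviation (input) "J2 \<equiv> weighted_integral s (\<alpha> - 2)"

lemmas J_add = weighted_integral_add[OF s_pos]
  and J_diff = weighted_integral_diff[OF s_pos]
  and J_smult = weighted_integral_smult

lemma J1_pCons_0: "J1 (pCons 0 q) = J0 q"
  by (simp add: weighted_integral_pCons_0)

lemma J2_pCons_0: "J2 (pCons 0 q) = J1 q"
  by (simp add: weighted_integral_pCons_0)

lemma degree_P [simp]: "degree (P n) = n"
  and coeff_P_self [simp]: "coeff (P n) n = 1"
  using monic_orthogonal_polys unfolding monic_orthogonal_polys_def by metis+

lemma J0_P_P: "J0 (P j * P k) = (if j = k then h j else 0)"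
  using monic_orthogonal_polys
  by (simp add: monic_orthogonal_polys_def weighted_integral_def)

text \<open>Subtracting a multiple of \<open>P (degree q)\<close> removes the leading term of
  \<open>q\<close>. \<open>R\<close> is arbitrary so that the remainder of the recurrence below can
  be tested against itself.\<close>

lemma J0_orthogonal_lower:
  assumes R: "\<And>k. k < n \<Longrightarrow> J0 (R * P k) = 0" and "degree q < n"
  shows "J0 (R * q) = 0"
  using \<open>degree q < n\<close>
proof (induction "degree q" arbitrary: q rule: less_induct)
  case less
  define r where "r = q - smult (lead_coeff q) (P (degree q))"
  have "r = 0 \<or> degree r < degree q"
    unfolding r_def by (intro eq_zero_or_degree_less degree_diff_le) auto
  then have "J0 (R * r) = 0"
    using less by auto
  moreover have "R * q = smult (lead_coeff q) (R * P (degree q)) + R * r"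
    by (simp add: r_def algebra_simps)
  ultimately show ?case
    using R less.prems by (simp add: J_add J_smult)
qed

lemma J0_P_times:
  assumes "degree q \<le> n"
  shows "J0 (P n * q) = coeff q n * h n"
proof -
  define r where "r = q - smult (coeff q n) (P n)"
  have "r = 0 \<or> degree r < n"
    unfolding r_def using assms by (intro eq_zero_or_degree_less degree_diff_le) auto
  then have "J0 (P n * r) = 0"
    using J0_orthogonal_lower[of n "P n" r] by (auto simp: J0_P_P)
  moreover have "P n * q = smult (coeff q n) (P n * P n) + P n * r"
    by (simp add: r_def algebra_simps)
  ultimately show ?thesis
    by (simp add: J_add J_smult J0_P_P)
qed

lemma h_nonzero: "h n \<noteq> 0"
  using weighted_integral_square_eq_0[OF s_pos, of \<alpha> "P n"] J0_P_P[of n n]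
  by (metis coeff_0 coeff_P_self zero_neq_one)

text \<open>In \<open>f = c + y * g\<close> the division cancels in the second summand, where
  orthogonality leaves only the coefficient of \<open>g\<close> at degree \<open>n\<close>.\<close>

lemma J1_P_times:
  assumes "degree f \<le> Suc n"
  shows "J1 (P n * f) = coeff f 0 * J1 (P n) + coeff f (Suc n) * h n"
proof (cases f)
  case (pCons c g)
  have "degree g \<le> n"
    using assms pCons by (auto split: if_splits)
  moreover have "P n * f = smult c (P n) + pCons 0 (P n * g)"
    by (simp add: pCons)
  ultimately show ?thesis
    by (simp add: J_add J_smult J1_pCons_0 J0_P_times pCons)
qed

lemma J2_P_times:
  assumes "degree f \<le> Suc n"
  shows "J2 (P n * f) = coeff f 0 * J2 (P n) + coeff f 1 * J1 (P n)"
proof (cases f)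
  case f: (pCons c g)
  show ?thesis
  proof (cases g)
    case g: (pCons d k)
    \<comment> \<open>Phrased by a vanishing coefficient to cover \<open>n = 0\<close>, where
      \<open>k\<close> is 0; hence \<open>P n * k\<close> integrates to 0.\<close>
    have "degree k \<le> n \<and> coeff k n = 0"
      using assms f g by (auto split: if_splits intro: coeff_eq_0)
    moreover have "P n * f = smult c (P n) + pCons 0 (smult d (P n) + pCons 0 (P n * k))"
      by (simp add: f g)
    ultimately show ?thesis
      by (simp add: J_add J_smult J1_pCons_0 J2_pCons_0 J0_P_times f g)
  qed
qed

section \<open>Integration by parts for products of the \<open>P n\<close>, and the
  recurrence\<close>

lemma by_parts: "J0 (pderiv q) + \<alpha> * J1 q + s * J2 q = J0 q"
  by (rule weighted_integral_by_parts[OF s_pos])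

text \<open>The derivative term drops out, since \<open>pderiv (P n)\<close> has no coefficient at
  degree \<open>n\<close>.\<close>

lemma by_parts_square: "\<alpha> * J1 (P n * P n) + s * J2 (P n * P n) = h n"
  using by_parts[of "P n * P n"]
  by (simp add: pderiv_square J_smult J0_P_P J0_P_times degree_pderiv coeff_pderiv coeff_eq_0)

text \<open>Of the two derivative terms only \<open>P m * pderiv (P (Suc m))\<close> survives, with
  leading coefficient \<open>Suc m\<close>.\<close>

lemma by_parts_consecutive:
  "real (Suc m) * h m + \<alpha> * J1 (P m * P (Suc m)) + s * J2 (P m * P (Suc m)) = 0"
  using by_parts[of "P m * P (Suc m)"]
  by (simp add: pderiv_mult J_add J0_P_P J0_P_times degree_pderiv coeff_pderiv coeff_eq_0)

text \<open>Divided by \<open>h n\<close>, this is the diagonal recurrence coefficient,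
  \<open>2 * n + 1 + \<alpha> + a n\<close>.\<close>

lemma by_parts_X_square:
  "J0 (pCons 0 (P n * P n)) = (2 * real n + 1 + \<alpha>) * h n + s * J1 (P n * P n)"
proof -
  have "degree (pCons 0 (pderiv (P n))) \<le> n"
    by (cases n) (auto simp: degree_pderiv pderiv_eq_0_iff)
  moreover have "coeff (pCons 0 (pderiv (P n))) n = real n"
    by (cases n) (auto simp: coeff_pderiv)
  ultimately have "J0 (P n * pCons 0 (pderiv (P n))) = real n * h n"
    by (simp add: J0_P_times del: mult_pCons_right)
  moreover have "pderiv (pCons 0 (P n * P n))
      = P n * P n + smult 2 (P n * pCons 0 (pderiv (P n)))"
    by (simp add: pderiv_pCons pderiv_square)
  ultimately have "J0 (pderiv (pCons 0 (P n * P n))) = (2 * real n + 1) * h n"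
    by (simp add: J_add J_smult J0_P_P algebra_simps del: mult_pCons_right)
  then show ?thesis
    using by_parts[of "pCons 0 (P n * P n)"]
    by (simp add: J1_pCons_0 J2_pCons_0 J0_P_P algebra_simps)
qed

text \<open>For \<open>n = 0\<close> the last term vanishes; \<open>P (n - 1)\<close> is then the junk value \<open>P 0\<close>.\<close>
lemma three_term_recurrence:
  fixes n :: nat
  defines "\<gamma> \<equiv> (if n = 0 then 0 else h n / h (n - 1))"
  shows "pCons 0 (P n) = P (Suc n) + smult (J0 (pCons 0 (P n * P n)) / h n) (P n)
    + smult \<gamma> (P (n - 1))"
proof -
  \<comment> \<open>The remainder has degree at most \<open>n\<close> and is orthogonal to
    \<open>P 0\<close>, ..., \<open>P n\<close>, hence to itself, so it is zero.\<close>
  define R where "R = pCons 0 (P n) - P (Suc n)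
    - smult (J0 (pCons 0 (P n * P n)) / h n) (P n) - smult \<gamma> (P (n - 1))"
  have "coeff R i = 0" if "n < i" for i
    using that coeff_P_self[of "Suc n"] coeff_P_self[of n] unfolding R_def
    by (cases "i = Suc n") (auto simp: coeff_eq_0 coeff_pCons split: nat.splits)
  then have degree: "degree R < Suc n"
    by (meson degree_le less_Suc_eq_le)
  have "J0 (R * P k) = 0" if "k < Suc n" for k
  proof -
    have expand: "J0 (R * P k) = J0 (P n * pCons 0 (P k)) - J0 (P (Suc n) * P k)
      - J0 (pCons 0 (P n * P n)) / h n * J0 (P n * P k) - \<gamma> * J0 (P (n - 1) * P k)"
      by (simp add: R_def algebra_simps J_add J_diff J_smult)
    consider "k = n" | "Suc k = n" | "Suc k < n"
      using \<open>k < Suc n\<close> by linarith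
    then show ?thesis
    proof cases
      case 1
      then show ?thesis
        unfolding expand by (auto simp: J0_P_P h_nonzero \<gamma>_def)
    next
      case 2
      \<comment> \<open>Here \<open>pCons 0 (P k)\<close> is monic of degree \<open>n\<close>; the
        \<gamma> term cancels this value.\<close>
      have "J0 (P n * pCons 0 (P k)) = h n"
        using 2 by (subst J0_P_times) auto
      then show ?thesis
        unfolding expand using 2 by (auto simp: J0_P_P h_nonzero \<gamma>_def)
    next
      case 3
      have "J0 (P n * pCons 0 (P k)) = 0"
        using 3 by (subst J0_P_times) (auto simp: coeff_eq_0 degree_pCons_eq_if)
      then show ?thesis
        unfolding expand using 3 by (auto simp: J0_P_P)
    qed
  qed
  then have "J0 (R * R) = 0"
    using degree by (rule J0_orthogonal_lower)
  then have "R = 0"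
    by (rule weighted_integral_square_eq_0[OF s_pos])
  then show ?thesis
    by (simp add: R_def algebra_simps)
qed

section \<open>The two difference equations\<close>

lemma a_coeff_eq: "a_coeff \<alpha> s P h n = s / h n * J1 (P n * P n)"
proof -
  have "(LBINT y:{0<..}. (poly (P n) y)\<^sup>2 / y * weight \<alpha> s y) = J1 (P n * P n)"
    unfolding weighted_integral_def
    by (rule set_lebesgue_integral_cong) (auto simp: weight_def powr_diff power2_eq_square)
  then show ?thesis by (simp add: a_coeff_def)
qed

lemma b_coeff_Suc_eq: "b_coeff \<alpha> s P h (Suc m) = s / h m * J1 (P m * P (Suc m))"
proof -
  have "(LBINT y:{0<..}. poly (P (Suc m)) y * poly (P m) y / y * weight \<alpha> s y)
      = J1 (P m * P (Suc m))"
    unfolding weighted_integral_def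
    by (rule set_lebesgue_integral_cong) (auto simp: weight_def powr_diff)
  then show ?thesis by (simp add: b_coeff_def)
qed

text \<open>Multiply the recurrence by \<open>P n\<close> and apply \<open>J1\<close>: the left side
  becomes \<open>h n\<close>, and the terms on the right become \<open>b (n + 1)\<close>,
  \<open>a n\<close> and \<open>b n\<close> after scaling by \<open>s / h n\<close>.\<close>

lemma b_coeff_add_b_coeff:
  defines "a \<equiv> a_coeff \<alpha> s P h" and "b \<equiv> b_coeff \<alpha> s P h"
  shows "b (n + 1) + b n = s - (2 * real n + 1 + \<alpha> + a n) * a n"
proof -
  define \<gamma> where "\<gamma> = (if n = 0 then 0 else h n / h (n - 1))"
  have "J0 (pCons 0 (P n * P n)) / h n = 2 * real n + 1 + \<alpha> + a n"
    using h_nonzero[of n] by (simp add: a_def a_coeff_eq by_parts_X_square field_simps)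
  then have "pCons 0 (P n)
      = P (Suc n) + smult (2 * real n + 1 + \<alpha> + a n) (P n) + smult \<gamma> (P (n - 1))"
    using three_term_recurrence[of n] unfolding \<gamma>_def by metis
  then have "P n * pCons 0 (P n)
      = P n * (P (Suc n) + smult (2 * real n + 1 + \<alpha> + a n) (P n) + smult \<gamma> (P (n - 1)))"
    by simp
  then have "pCons 0 (P n * P n) = P n * P (Suc n)
      + smult (2 * real n + 1 + \<alpha> + a n) (P n * P n) + smult \<gamma> (P n * P (n - 1))"
    by (simp only: distrib_left mult_pCons_right mult_smult_right smult_0_left add_0)
  then have "J1 (pCons 0 (P n * P n)) = J1 (P n * P (Suc n))
      + (2 * real n + 1 + \<alpha> + a n) * J1 (P n * P n) + \<gamma> * J1 (P n * P (n - 1))"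
    by (simp add: J_add J_smult)
  then have "h n = J1 (P n * P (Suc n))
      + (2 * real n + 1 + \<alpha> + a n) * J1 (P n * P n) + \<gamma> * J1 (P n * P (n - 1))"
    by (simp only: J1_pCons_0 J0_P_P if_True simp_thms)
  then have "s / h n * h n = s / h n * (J1 (P n * P (Suc n))
      + (2 * real n + 1 + \<alpha> + a n) * J1 (P n * P n) + \<gamma> * J1 (P n * P (n - 1)))"
    by (rule arg_cong)
  then have "s / h n * h n = s / h n * J1 (P n * P (Suc n))
      + (2 * real n + 1 + \<alpha> + a n) * (s / h n * J1 (P n * P n))
      + s / h n * \<gamma> * J1 (P n * P (n - 1))"
    by (simp only: distrib_left mult_ac)
  \<comment> \<open>The factor \<gamma> changes the normalisation from \<open>h n\<close> to
    \<open>h (n - 1)\<close>; at \<open>n = 0\<close> both sides are zero by convention.\<close>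
  moreover have "s / h n * \<gamma> * J1 (P n * P (n - 1)) = b n"
  proof (cases n)
    case 0
    then show ?thesis by (simp add: \<gamma>_def b_def b_coeff_def)
  next
    case (Suc m)
    then show ?thesis
      using h_nonzero[of n] by (simp add: \<gamma>_def b_def b_coeff_Suc_eq mult.commute)
  qed
  ultimately show ?thesis
    using h_nonzero[of n] by (simp add: a_def b_def a_coeff_eq b_coeff_Suc_eq)
qed

lemma b_coeff_square_diff:
  fixes m :: nat
  defines "a \<equiv> a_coeff \<alpha> s P h" and "b \<equiv> b_coeff \<alpha> s P h"
  shows "((b (Suc m))\<^sup>2 - s * b (Suc m)) * (a (Suc m) + a m)
    = (real (Suc m) * s - (2 * real (Suc m) + \<alpha>) * b (Suc m)) * a (Suc m) * a m"
proof -
  \<comment> \<open>Values and first derivatives at 0 of \<open>P (Suc m)\<close> and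
    \<open>P m\<close>.\<close>
  define p p' r r' where "p = coeff (P (Suc m)) 0" and "p' = coeff (P (Suc m)) 1"
    and "r = coeff (P m) 0" and "r' = coeff (P m) 1"
  define X X2 Y Y2 where "X = J1 (P (Suc m))" and "X2 = J2 (P (Suc m))"
    and "Y = J1 (P m)" and "Y2 = J2 (P m)"
  define H G N where "H = h (Suc m)" and "G = h m" and "N = real (Suc m)"
  have nz: "H \<noteq> 0" "G \<noteq> 0"
    by (simp_all add: H_def G_def h_nonzero)
  have J1_nn: "J1 (P (Suc m) * P (Suc m)) = p * X"
    by (simp add: J1_P_times p_def X_def coeff_eq_0)
  have J1_mm: "J1 (P m * P m) = r * Y"
    by (simp add: J1_P_times r_def Y_def coeff_eq_0)
  have J1_mn: "J1 (P m * P (Suc m)) = p * Y + G"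
    by (simp add: J1_P_times p_def Y_def G_def)
  have "J1 (P (Suc m) * P m) = r * X"
    by (simp add: J1_P_times r_def X_def coeff_eq_0)
  then have J1_nm: "J1 (P m * P (Suc m)) = r * X"
    by (simp add: mult.commute)
  have J2_nn: "J2 (P (Suc m) * P (Suc m)) = p * X2 + p' * X"
    by (simp add: J2_P_times p_def p'_def X_def X2_def)
  have J2_mm: "J2 (P m * P m) = r * Y2 + r' * Y"
    by (simp add: J2_P_times r_def r'_def Y_def Y2_def)
  have J2_mn: "J2 (P m * P (Suc m)) = p * Y2 + p' * Y"
    by (simp add: J2_P_times p_def p'_def Y_def Y2_def)
  have "J2 (P (Suc m) * P m) = r * X2 + r' * X"
    by (simp add: J2_P_times r_def r'_def X_def X2_def)
  then have J2_nm: "J2 (P m * P (Suc m)) = r * X2 + r' * X"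
    by (simp add: mult.commute)
  \<comment> \<open>One integral reduced in two ways; \<open>G\<close> comes from the leading
    coefficient of \<open>P (Suc m)\<close> as a factor beside \<open>P m\<close>.\<close>
  have pY: "p * Y + G = r * X"
    using J1_mn J1_nm by simp
  have 1: "\<alpha> * (p * X) + s * (p * X2 + p' * X) = H"
    using by_parts_square[of "Suc m"] J1_nn J2_nn by (simp add: H_def)
  have 2: "N * G + \<alpha> * (r * X) + s * (r * X2 + r' * X) = 0"
    using by_parts_consecutive[of m] J1_nm J2_nm by (simp add: N_def G_def)
  \<comment> \<open>Taking \<open>r\<close> times \<open>1\<close> minus \<open>p\<close> times
    \<open>2\<close> eliminates \<open>X2\<close>.\<close>
  have eqX: "s * (p' * r - p * r') * X = r * H + N * p * G"
  proof -
    have "s * (p' * r - p * r') * X = r * (\<alpha> * (p * X) + s * (p * X2 + p' * X))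
        - p * (N * G + \<alpha> * (r * X) + s * (r * X2 + r' * X)) + N * p * G"
      by (simp add: algebra_simps)
    then show ?thesis
      using 1 2 by simp
  qed
  have 3: "\<alpha> * (r * Y) + s * (r * Y2 + r' * Y) = G"
    using by_parts_square[of m] J1_mm J2_mm by (simp add: G_def)
  have 4: "N * G + \<alpha> * (p * Y + G) + s * (p * Y2 + p' * Y) = 0"
    using by_parts_consecutive[of m] J1_mn J2_mn by (simp add: N_def G_def)
  \<comment> \<open>Taking \<open>p\<close> times \<open>3\<close> minus \<open>r\<close> times
    \<open>4\<close> eliminates \<open>Y2\<close>; the determinant has the opposite sign.\<close>
  have eqY: "s * (p * r' - p' * r) * Y = p * G + N * r * G + \<alpha> * r * G"
  proof -
    have "s * (p * r' - p' * r) * Y = p * (\<alpha> * (r * Y) + s * (r * Y2 + r' * Y))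
        - r * (N * G + \<alpha> * (p * Y + G) + s * (p * Y2 + p' * Y)) + N * r * G + \<alpha> * r * G"
      by (simp add: algebra_simps)
    then show ?thesis
      using 3 4 by simp
  qed
  \<comment> \<open>Adding \<open>Y\<close> times \<open>eqX\<close> and \<open>X\<close> times
    \<open>eqY\<close> cancels the determinant, the last trace of the derivatives at 0.\<close>
  have key: "G * (N * G - (2 * N + \<alpha>) * (r * X)) = G * (p * X) + H * (r * Y)"
  proof -
    have "s * (p' * r - p * r') * X * Y + s * (p * r' - p' * r) * Y * X = 0"
      by (simp add: algebra_simps)
    then have "(r * H + N * p * G) * Y + (p * G + N * r * G + \<alpha> * r * G) * X = 0"
      by (simp only: eqX eqY)
    then have "r * H * Y + N * G * (p * Y) + (p * G + N * r * G + \<alpha> * r * G) * X = 0"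
      by (simp add: algebra_simps)
    moreover have pY': "p * Y = r * X - G"
      using pY by simp
    ultimately have "r * H * Y + N * G * (r * X - G) + (p * G + N * r * G + \<alpha> * r * G) * X = 0"
      by (simp only: pY')
    then show ?thesis
      by (simp add: algebra_simps)
  qed
  have a_n: "a (Suc m) = s * (p * X) / H" and a_m: "a m = s * (r * Y) / G"
    and b_n: "b (Suc m) = s * (r * X) / G"
    by (simp_all add: a_def b_def a_coeff_eq b_coeff_Suc_eq J1_nn J1_mm J1_nm H_def G_def)
  have "(b (Suc m))\<^sup>2 - s * b (Suc m) = H / G * (a (Suc m) * a m)"
  proof -
    \<comment> \<open>By \<open>pY\<close>, subtracting \<open>s\<close> swaps \<open>r * X\<close>
      for \<open>p * Y\<close>, so the product contains the factors of both \<open>a\<close>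
      values.\<close>
    have "b (Suc m) - s = s * (p * Y) / G"
      using nz by (simp add: b_n distrib_left add_divide_distrib flip: pY)
    then have "b (Suc m) * (b (Suc m) - s) = (s * (r * X) / G) * (s * (p * Y) / G)"
      by (simp add: b_n)
    then show ?thesis
      using nz by (simp add: a_n a_m field_simps power2_eq_square)
  qed
  moreover have "H / G * (a (Suc m) + a m) = N * s - (2 * N + \<alpha>) * b (Suc m)"
  proof -
    have "G * G * (H / G * (a (Suc m) + a m)) = s * (G * (p * X) + H * (r * Y))"
      using nz by (simp add: a_n a_m field_simps)
    also have "\<dots> = G * G * (N * s - (2 * N + \<alpha>) * b (Suc m))"
      unfolding key[symmetric] using nz by (simp add: b_n field_simps)
    finally show ?thesis using nz by simp
  qed
  \<comment> \<open>The first identity times \<open>a (Suc m) + a m\<close> meets the second times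
    \<open>a (Suc m) * a m\<close>, without any division.\<close>
  moreover have "H / G * (a (Suc m) * a m) * (a (Suc m) + a m)
      = H / G * (a (Suc m) + a m) * a (Suc m) * a m"
    by (simp only: mult_ac)
  ultimately show ?thesis
    by (simp only: N_def)
qed

lemma a_coeff_0:
  "a_coeff \<alpha> s P h 0 = s * (LBINT x:{0<..}. weight (\<alpha> - 1) s x) / (LBINT x:{0<..}. weight \<alpha> s x)"
proof -
  have "P 0 = 1"
    using degree_P[of 0] coeff_P_self[of 0] by (metis degree_eq_zeroE coeff_pCons_0 one_pCons)
  then show ?thesis
    using J0_P_P[of 0 0] by (simp add: a_coeff_eq weighted_integral_def)
qed

end

section \<open>Moments of the weight as Bessel functions\<close>

lemma bessel_K_integrand:
  fixes s \<nu> :: real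
  assumes s: "0 < s"
  defines "f \<equiv> \<lambda>t. exp (\<nu> * t) * exp (- (2 * sqrt s) * cosh t)"
  shows "set_integrable lborel UNIV f"
    and "(LBINT x:{0<..}. weight (\<nu> - 1) s x) = s powr (\<nu> / 2) * (LBINT t=-\<infinity>..\<infinity>. f t)"
proof -
  \<comment> \<open>Under \<open>x = sqrt s * exp t\<close> the sum \<open>x + s / x\<close> becomes
    \<open>2 * sqrt s * cosh t\<close>. Substituting in the direction from \<open>x\<close> to
    \<open>t\<close> transfers integrability from the weight to \<open>f\<close>.\<close>
  let ?g = "\<lambda>x. ln (x / sqrt s)"
  have fg: "f (?g x) * (1 / x) = s powr (- \<nu> / 2) * weight (\<nu> - 1) s x" if x: "0 < x" for x
  proof -
    have "2 * sqrt s * cosh (?g x) = x + s / x"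
      using s x by (simp add: cosh_ln_real field_simps)
    moreover have "exp (\<nu> * ?g x) = s powr (- \<nu> / 2) * x powr \<nu>"
      using s x by (simp add: powr_def ln_div ln_sqrt algebra_simps flip: exp_add)
    ultimately show ?thesis
      using x by (simp add: f_def weight_def powr_diff)
  qed
  have int: "set_integrable lborel {0<..} (\<lambda>x. f (?g x) * (1 / x))"
  proof (rule set_integrable_cong[THEN iffD2])
    show "set_integrable lborel {0<..} (\<lambda>x. s powr (- \<nu> / 2) * weight (\<nu> - 1) s x)"
      using set_integrable_weight[OF s] by simp
  qed (use fg in auto)
  have A: "((ereal \<circ> ?g \<circ> real_of_ereal) \<longlongrightarrow> -\<infinity>) (at_right (ereal 0))"
  proof -
    have "filterlim ?g at_bot (at_right 0)"
      using s by real_asymp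
    then show ?thesis
      unfolding ereal_tendsto_simps by (simp add: ereal_tendsto_simps comp_def)
  qed
  have B: "((ereal \<circ> ?g \<circ> real_of_ereal) \<longlongrightarrow> \<infinity>) (at_left \<infinity>)"
  proof -
    have "filterlim ?g at_top at_top"
      using s by real_asymp
    then show ?thesis
      unfolding ereal_tendsto_simps by (simp add: ereal_tendsto_simps comp_def)
  qed
  have "set_integrable lborel (einterval (-\<infinity>) \<infinity>) f \<and>
    (LBINT t=-\<infinity>..\<infinity>. f t) = (LBINT x=ereal 0..\<infinity>. f (?g x) * (1 / x))"
  proof (intro conjI)
    have deriv: "(?g has_real_derivative 1 / x) (at x)" if "ereal 0 < ereal x" for x
      using that s by (auto intro!: derivative_eq_intros simp: field_simps)
    have cont: "isCont f (?g x)" "isCont (\<lambda>x. 1 / x) x" if "ereal 0 < ereal x" for x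
      using that unfolding f_def by (auto intro!: continuous_intros)
    note subst = interval_integral_substitution_nonneg[where f = f and g = ?g
        and g' = "\<lambda>x. 1 / x", OF _ deriv cont(1) cont(2) _ _ A B]
    show "set_integrable lborel (einterval (-\<infinity>) \<infinity>) f"
      by (rule subst) (use int in \<open>auto simp: f_def\<close>)
    show "(LBINT t=-\<infinity>..\<infinity>. f t) = (LBINT x=ereal 0..\<infinity>. f (?g x) * (1 / x))"
      by (rule subst) (use int in \<open>auto simp: f_def\<close>)
  qed
  then have f: "set_integrable lborel UNIV f"
    and eq: "(LBINT t=-\<infinity>..\<infinity>. f t) = (LBINT x:{0<..}. f (?g x) * (1 / x))"
    unfolding interval_integral_to_infinity_eq by simp_all
  show "set_integrable lborel UNIV f" by (rule f)
  have "(LBINT x:{0<..}. f (?g x) * (1 / x))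
      = (LBINT x:{0<..}. s powr (- \<nu> / 2) * weight (\<nu> - 1) s x)"
    by (rule set_lebesgue_integral_cong) (use fg in auto)
  then show "(LBINT x:{0<..}. weight (\<nu> - 1) s x) = s powr (\<nu> / 2) * (LBINT t=-\<infinity>..\<infinity>. f t)"
    using s by (simp add: eq flip: powr_add)
qed

text \<open>Reflecting the negative half-line pairs \<open>exp (\<nu> * t)\<close> with
  \<open>exp (- \<nu> * t)\<close>, giving \<open>2 * cosh (\<nu> * t)\<close>.\<close>

lemma integral_weight_eq_bessel_K:
  assumes s: "0 < s"
  shows "(LBINT x:{0<..}. weight (\<nu> - 1) s x) = 2 * s powr (\<nu> / 2) * bessel_K \<nu> (2 * sqrt s)"
proof -
  define f where "f \<mu> t = exp (\<mu> * t) * exp (- (2 * sqrt s) * cosh t)" for \<mu> t :: real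
  have f: "set_integrable lborel UNIV (f \<mu>)" for \<mu>
    unfolding f_def[abs_def] by (rule bessel_K_integrand(1)[OF s])
  then have f_pos: "set_integrable lborel {0<..} (f \<mu>)" for \<mu>
    by (rule set_integrable_subset) auto
  have "(LBINT t=-\<infinity>..\<infinity>. f \<nu> t) = (LBINT t=-\<infinity>..ereal 0. f \<nu> t) + (LBINT t=ereal 0..\<infinity>. f \<nu> t)"
    by (rule interval_integral_sum[symmetric])
       (use f[of \<nu>] in \<open>simp add: interval_lebesgue_integrable_def\<close>)
  also have "(LBINT t=-\<infinity>..ereal 0. f \<nu> t) = (LBINT t=ereal 0..\<infinity>. f (- \<nu>) t)"
    by (subst interval_integral_reflect) (simp add: f_def[abs_def])
  also have "\<dots> + (LBINT t=ereal 0..\<infinity>. f \<nu> t) = (LBINT t:{0<..}. f (- \<nu>) t + f \<nu> t)"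
    unfolding interval_integral_to_infinity_eq using f_pos by simp
  also have "\<dots> = (LBINT t:{0<..}. 2 * (exp (- (2 * sqrt s) * cosh t) * cosh (\<nu> * t)))"
    by (rule set_lebesgue_integral_cong) (auto simp: f_def cosh_def field_simps)
  also have "\<dots> = 2 * bessel_K \<nu> (2 * sqrt s)"
    by (simp add: bessel_K_def)
  finally show ?thesis
    using bessel_K_integrand(2)[OF s, of \<nu>] by (simp add: f_def)
qed

theorem mainTheorem6:
  fixes \<alpha> s :: real and P :: "nat \<Rightarrow> real poly" and h a b :: "nat \<Rightarrow> real"
  assumes "\<alpha> > 0" and "s > 0"
    and "monic_orthogonal_polys \<alpha> s P h"
  defines "a \<equiv> a_coeff \<alpha> s P h" and "b \<equiv> b_coeff \<alpha> s P h"
  shows "(\<forall>n. b (n + 1) + b n = s - (2 * real n + 1 + \<alpha> + a n) * a n) \<and>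
    (\<forall>n\<ge>1. ((b n)\<^sup>2 - s * b n) * (a n + a (n - 1))
            = (real n * s - (2 * real n + \<alpha>) * b n) * a n * a (n - 1)) \<and>
    a 0 = sqrt s * bessel_K \<alpha> (2 * sqrt s) / bessel_K (\<alpha> + 1) (2 * sqrt s) \<and>
    b 0 = 0"
proof (intro conjI allI impI)
  interpret monic_orthogonal \<alpha> s P h
    by unfold_locales fact+
  show "b (n + 1) + b n = s - (2 * real n + 1 + \<alpha> + a n) * a n" for n
    unfolding a_def b_def by (rule b_coeff_add_b_coeff)
  show "((b n)\<^sup>2 - s * b n) * (a n + a (n - 1))
      = (real n * s - (2 * real n + \<alpha>) * b n) * a n * a (n - 1)" if "1 \<le> n" for n
    using that b_coeff_square_diff[of "n - 1"] by (simp add: a_def b_def)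
  define K L where "K = bessel_K \<alpha> (2 * sqrt s)" and "L = bessel_K (\<alpha> + 1) (2 * sqrt s)"
  define u where "u = s powr (\<alpha> / 2)"
  have "u > 0" "sqrt s > 0"
    using \<open>s > 0\<close> by (simp_all add: u_def)
  have "(LBINT x:{0<..}. weight (\<alpha> - 1) s x) = 2 * u * K"
    using integral_weight_eq_bessel_K[OF \<open>s > 0\<close>, of \<alpha>] by (simp add: u_def K_def)
  \<comment> \<open>The denominator moment has order \<open>\<alpha> + 1\<close>; its extra
    \<open>sqrt s\<close> reduces the prefactor \<open>s\<close> to \<open>sqrt s\<close>.\<close>
  moreover have "s powr ((\<alpha> + 1) / 2) = u * sqrt s"
    using \<open>s > 0\<close> by (simp add: u_def add_divide_distrib powr_add powr_half_sqrt)
  then have "(LBINT x:{0<..}. weight \<alpha> s x) = 2 * (u * sqrt s) * L"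
    using integral_weight_eq_bessel_K[OF \<open>s > 0\<close>, of "\<alpha> + 1"] by (simp add: L_def)
  moreover have "s = sqrt s * sqrt s"
    using \<open>s > 0\<close> by simp
  then have "s * (2 * u * K) = sqrt s * K * (2 * (u * sqrt s))"
    by (metis mult.assoc mult.commute)
  ultimately have "a 0 = sqrt s * K * (2 * (u * sqrt s)) / (L * (2 * (u * sqrt s)))"
    unfolding a_def a_coeff_0 by (simp only: mult_ac)
  also have "\<dots> = sqrt s * K / L"
    using \<open>u > 0\<close> \<open>sqrt s > 0\<close> by (intro mult_divide_mult_cancel_right) simp
  finally show "a 0 = sqrt s * bessel_K \<alpha> (2 * sqrt s) / bessel_K (\<alpha> + 1) (2 * sqrt s)"
    by (simp only: K_def L_def)
  show "b 0 = 0"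
    by (simp add: b_def b_coeff_def)
qed

end
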